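(* Let $G$ be a locally compact étale groupoid with Hausdorff unit space $G^0$, and let $S$ be the $*$-semigroup of continuous functions $a:\mathrm{dom}(a)\to\mathbb{D}\setminus\{0\}$ vanishing at infinity on open bisections $\mathrm{dom}(a)\subseteq G$, with $E=\{a\in S:\mathrm{dom}(a)\subseteq G^0\}$. For $a,b\in S$ write $a\precsim b$ if $\mathrm{dom}(a)\subseteq b^{-1}[\mathbb{T}]$. Then for any $a,b\in S$, \[a\precsim b\qquad\Leftrightarrow\qquad a=ab^*b\quad\text{and}\quad ab^*\in E.\]
   Context: The inverse of an element $g$ of a groupoid is written $g^*$; a product $gh$ is defined iff $g^*g=hh^*$; $G^0$ is the set of units. For $O,N\subseteq G$, $O^*=\{g^*:g\in O\}$ and $ON=\{gh:g\in O,h\in N,\ gh\text{ defined}\}$. An étale groupoid is a topological groupoid (continuous inverse and product) whose product is an open map and whose unit space $G^0$ is open in $G$ (equivalently, the source map $g\mapsto g^*g$ is a local homeomorphism). Locally compact means every point has a neighbourhood base of compact sets; $G$ itself need not be Hausdorff. A bisection is a subset $O\subseteq G$ with $OO^*\cup O^*O\subseteq G^0$. $\mathbb{D}=\{\alpha\in\mathbb{C}:|\alpha|\le1\}$, $\mathbb{T}=\{\alpha\in\mathbb{C}:|\alpha|=1\}$. $S$ is the set of all functions $a$ such that the domain $\mathrm{dom}(a)$ is an open bisection of $G$ (possibly empty), $a:\mathrm{dom}(a)\to\mathbb{D}\setminus\{0\}$ is continuous, and $a$ vanishes at infinity on $\mathrm{dom}(a)$, i.e. $\{g\in\mathrm{dom}(a):|a(g)|\ge\epsilon\}$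 is compact for every $\epsilon>0$. The involution and product on $S$ are: $\mathrm{dom}(a^* )=\mathrm{dom}(a)^*$, $a^*(g)=\overline{a(g^* )}$; $\mathrm{dom}(ab)=\mathrm{dom}(a)\mathrm{dom}(b)$ and $ab(gh)=a(g)b(h)$ for $g\in\mathrm{dom}(a)$, $h\in\mathrm{dom}(b)$ with $g^*g=hh^*$. *)

theory Defs
  imports "HOL-Analysis.Analysis"
begin

text \<open>The carrier of a groupoid is the point set of its topology. The product is a total HOL
  function whose values are meaningful only on composable pairs.\<close>

record 'g groupoid_data =
  topo :: "'g topology"
  gmult :: "'g \<Rightarrow> 'g \<Rightarrow> 'g" (infixl "\<cdot>\<index>" 70)
  ginv :: "'g \<Rightarrow> 'g" ("star\<index> _" [81] 80)

abbreviation points :: "('g, 'm) groupoid_data_scheme \<Rightarrow> 'g set"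
  where "points G \<equiv> topspace (topo G)"

definition composable :: "('g, 'm) groupoid_data_scheme \<Rightarrow> 'g \<Rightarrow> 'g \<Rightarrow> bool"
  where "composable G g h \<longleftrightarrow> g \<in> points G \<and> h \<in> points G \<and>
    gmult G (ginv G g) g = gmult G h (ginv G h)"

definition units :: "('g, 'm) groupoid_data_scheme \<Rightarrow> 'g set"
  where "units G = {gmult G (ginv G g) g | g. g \<in> points G}"

definition set_star :: "('g, 'm) groupoid_data_scheme \<Rightarrow> 'g set \<Rightarrow> 'g set"
  where "set_star G U = ginv G ` U"

definition set_mult :: "('g, 'm) groupoid_data_scheme \<Rightarrow> 'g set \<Rightarrow> 'g set \<Rightarrow> 'g set"
  where "set_mult G U N = {gmult G g h | g h. g \<in> U \<and> h \<in> N \<and> composable G g h}"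

definition bisection :: "('g, 'm) groupoid_data_scheme \<Rightarrow> 'g set \<Rightarrow> bool"
  where "bisection G U \<longleftrightarrow> U \<subseteq> points G \<and>
    set_mult G U (set_star G U) \<union> set_mult G (set_star G U) U \<subseteq> units G"

text \<open>Hahn's axioms for a groupoid, where the set of composable pairs is the one determined by
  the equality of source and range.\<close>

locale groupoid =
  fixes G :: "('g, 'm) groupoid_data_scheme" (structure)
  assumes inv_closed: "g \<in> points G \<Longrightarrow> star g \<in> points G"
    and inv_inv: "g \<in> points G \<Longrightarrow> star (star g) = g"
    and mult_closed: "composable G g h \<Longrightarrow> g \<cdot> h \<in> points G"
    and mult_composable_left: "composable G g h \<Longrightarrow> composable G h k \<Longrightarrow> composable G (g \<cdot> h) k"
    and mult_composable_right: "composable G g h \<Longrightarrow> composable G h k \<Longrightarrow> composable G g (h \<cdot> k)"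
    and mult_assoc: "composable G g h \<Longrightarrow> composable G h k \<Longrightarrow> (g \<cdot> h) \<cdot> k = g \<cdot> (h \<cdot> k)"
    and cancel_left: "composable G g h \<Longrightarrow> star g \<cdot> (g \<cdot> h) = h"
    and cancel_right: "composable G g h \<Longrightarrow> (g \<cdot> h) \<cdot> star h = g"

definition composable_topology :: "('g, 'm) groupoid_data_scheme \<Rightarrow> ('g \<times> 'g) topology"
  where "composable_topology G =
    subtopology (prod_topology (topo G) (topo G)) {(g, h). composable G g h}"

locale topological_groupoid = groupoid +
  assumes inv_continuous: "continuous_map (topo G) (topo G) (ginv G)"
    and mult_continuous:
      "continuous_map (composable_topology G) (topo G) (\<lambda>(g, h). g \<cdot> h)"

locale etale_groupoid = topological_groupoid +
  assumes mult_open: "open_map (composable_topology G) (topo G) (\<lambda>(g, h). g \<cdot> h)"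
    and units_open: "openin (topo G) (units G)"

text \<open>Since \<^term>\<open>G\<close> need not be Hausdorff, local compactness asks for a neighbourhood base of
  compact sets, which is a priori stronger than the library's \<^const>\<open>locally_compact_space\<close>.\<close>

locale locally_compact_etale_groupoid = etale_groupoid +
  assumes compact_base: "neighbourhood_base_of (compactin (topo G)) (topo G)"

text \<open>Functions with a domain are partial maps, so equality of such functions includes equality
  of their domains.\<close>

definition S :: "('g, 'm) groupoid_data_scheme \<Rightarrow> ('g \<rightharpoonup> complex) set"
  where "S G = {a.
    openin (topo G) (dom a) \<and> bisection G (dom a) \<and>
    ran a \<subseteq> cball 0 1 - {0} \<and>
    continuous_map (subtopology (topo G) (dom a)) euclidean (\<lambda>g. the (a g)) \<and>
    (\<forall>\<epsilon>>0. compactin (topo G) {g \<in> dom a. \<epsilon> \<le> cmod (the (a g))})}"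

definition E :: "('g, 'm) groupoid_data_scheme \<Rightarrow> ('g \<rightharpoonup> complex) set"
  where "E G = {a \<in> S G. dom a \<subseteq> units G}"

definition fun_star ::
    "('g, 'm) groupoid_data_scheme \<Rightarrow> ('g \<rightharpoonup> complex) \<Rightarrow> ('g \<rightharpoonup> complex)"
  where "fun_star G a =
    (\<lambda>g. if g \<in> set_star G (dom a) then Some (cnj (the (a (ginv G g)))) else None)"

text \<open>On bisections a product has at most one factorisation, so the description is proper;
  see \<open>fun_mult_apply\<close> below.\<close>

definition fun_mult ::
    "('g, 'm) groupoid_data_scheme \<Rightarrow> ('g \<rightharpoonup> complex) \<Rightarrow> ('g \<rightharpoonup> complex) \<Rightarrow> ('g \<rightharpoonup> complex)"
  where "fun_mult G a b =
    (\<lambda>k. if k \<in> set_mult G (dom a) (dom b)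
         then Some (THE z. \<exists>g\<in>dom a. \<exists>h\<in>dom b. composable G g h \<and> k = gmult G g h \<and>
                z = the (a g) * the (b h))
         else None)"

definition dom_below ::
    "('g \<rightharpoonup> complex) \<Rightarrow> ('g \<rightharpoonup> complex) \<Rightarrow> bool" (infix "\<precsim>" 50)
  where "a \<precsim> b \<longleftrightarrow> dom a \<subseteq> {g \<in> dom b. the (b g) \<in> sphere 0 1}"

lemma dom_fun_star: "dom (fun_star G a) = set_star G (dom a)"
  by (auto simp: fun_star_def split: if_splits)

lemma dom_fun_mult: "dom (fun_mult G a b) = set_mult G (dom a) (dom b)"
  by (auto simp: fun_mult_def split: if_splits)

context groupoid
begin

lemma composable_inv_right: "g \<in> points G \<Longrightarrow> composable G g (star g)"
  by (simp add: composable_def inv_closed inv_inv)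

lemma composable_inv_left: "g \<in> points G \<Longrightarrow> composable G (star g) g"
  by (simp add: composable_def inv_closed inv_inv)

lemma mult_range:
  assumes "composable G g h"
  shows "(g \<cdot> h) \<cdot> star (g \<cdot> h) = g \<cdot> star g"
proof -
  have g: "g \<in> points G" using assms by (simp add: composable_def)
  have "composable G (star g) (g \<cdot> h)"
    by (rule mult_composable_right[OF composable_inv_left[OF g] assms])
  then show ?thesis by (simp add: composable_def inv_inv g)
qed

lemma bisection_range_inj:
  assumes U: "bisection G U" and g: "g \<in> U" and h: "h \<in> U"
    and eq: "g \<cdot> star g = h \<cdot> star h"
  shows "g = h"
proof -
  have gP: "g \<in> points G" and hP: "h \<in> points G" using U g h by (auto simp: bisection_def)
  have c: "composable G (star g) h" using gP hP eq by (simp add: composable_def inv_closed inv_inv)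
  then have "star g \<cdot> h \<in> units G"
    using U g h unfolding bisection_def set_mult_def set_star_def by blast
  then obtain k where k: "k \<in> points G" and e: "star g \<cdot> h = star k \<cdot> k"
    by (auto simp: units_def)
  have ck: "composable G (star k \<cdot> k) (star k)"
    using composable_inv_left composable_inv_right inv_closed k mult_composable_left by meson
  have idem: "(star k \<cdot> k) \<cdot> (star k \<cdot> k) = star k \<cdot> k"
    by (metis cancel_right ck composable_inv_left composable_inv_right k mult_assoc)
  have cu: "composable G (star k \<cdot> k) (star k \<cdot> k)"
    by (metis ck composable_inv_left k mult_composable_right)
  have cgh: "composable G g (star g \<cdot> h)"
    using mult_composable_right[OF composable_inv_right[OF gP] c] .
  have "h = g \<cdot> (star g \<cdot> h)" using cancel_left[OF c] gP by (simp add: inv_inv)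
  moreover have "g \<cdot> (star g \<cdot> h) = g"
  proof -
    have "(g \<cdot> (star g \<cdot> h)) \<cdot> (star g \<cdot> h) = g \<cdot> (star g \<cdot> h)"
      using mult_assoc[OF cgh] cu idem e by simp
    then have "h \<cdot> (star g \<cdot> h) = h" using calculation by simp
    moreover have "(g \<cdot> (star g \<cdot> h)) \<cdot> star (star g \<cdot> h) = g"
      using cancel_right[OF cgh] .
    moreover have "composable G h (star g \<cdot> h)"
      using mult_composable_left[OF cgh] cu e \<open>h = g \<cdot> (star g \<cdot> h)\<close> by metis
    ultimately show ?thesis using cancel_right \<open>h = g \<cdot> (star g \<cdot> h)\<close> by metis
  qed
  ultimately show ?thesis by simp
qed

lemma fun_mult_apply:
  assumes a: "a \<in> S G" and g: "g \<in> dom a" and h: "h \<in> dom b" and c: "composable G g h"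
  shows "fun_mult G a b (g \<cdot> h) = Some (the (a g) * the (b h))"
proof -
  have U: "bisection G (dom a)" using a by (simp add: S_def)
  have *: "g' = g \<and> h' = h"
    if "g' \<in> dom a" "composable G g' h'" "g \<cdot> h = g' \<cdot> h'" for g' h'
  proof -
    have "g = g'" using bisection_range_inj[OF U g that(1)] mult_range c that by metis
    then show ?thesis using cancel_left c that by metis
  qed
  have "(THE z. \<exists>g'\<in>dom a. \<exists>h'\<in>dom b. composable G g' h' \<and> g \<cdot> h = g' \<cdot> h' \<and>
          z = the (a g') * the (b h')) = the (a g) * the (b h)"
    by (rule the_equality) (use * g h c in blast)+
  then show ?thesis using g h c by (auto simp: fun_mult_def set_mult_def)
qed

end

end

theory Submission imports Defs begin

text \<open>
  On an open bisection the range map \<open>g \<mapsto> g g\<^sup>*\<close> is a homeomorphism onto an open set of units,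
  and everything is transported along it.  If \<^term>\<open>a \<precsim> b\<close>, then \<^term>\<open>dom a\<close> lies in the
  bisection \<^term>\<open>dom b\<close>, so \<open>g h\<^sup>*\<close> with \<open>g \<in> dom a\<close>, \<open>h \<in> dom b\<close> is defined only for \<open>h = g\<close>.
  Hence \<open>ab\<^sup>*\<close> lives on the units \<open>g g\<^sup>*\<close>, where its value is \<open>a(g)\<close> times the conjugate of
  \<open>b(g)\<close>: it is the transport along the range map of a continuous function on \<^term>\<open>dom a\<close>.
  It vanishes at infinity because \<open>\<bar>b\<bar> = 1\<close> on \<^term>\<open>dom a\<close>, so that its modulus is the
  transport of \<open>\<bar>a\<bar>\<close> (lemma \<open>mult_star_in_E\<close>).  Multiplying by \<open>b\<close> moves the domain back from
  \<open>g g\<^sup>*\<close> to \<open>g\<close> and gives \<open>a(g) \<bar>b(g)\<bar>\<^sup>2 = a(g)\<close>.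

  Conversely, if \<open>ab\<^sup>*\<close> is supported on units, then multiplying by it on the left moves no point,
  so \<open>a = ab\<^sup>*b\<close> forces \<open>dom a \<subseteq> dom b\<close>.  The same evaluation gives \<open>a(g) = a(g) \<bar>b(g)\<bar>\<^sup>2\<close>,
  and \<open>a(g) \<noteq> 0\<close> yields \<open>\<bar>b(g)\<bar> = 1\<close>.
\<close>

section \<open>Units and the range map\<close>

context groupoid
begin

lemma range_in_units: "g \<in> points G \<Longrightarrow> g \<cdot> star g \<in> units G"
  unfolding units_def using inv_closed inv_inv by force

lemma range_mult_self: "g \<in> points G \<Longrightarrow> (g \<cdot> star g) \<cdot> g = g"
  using cancel_right[OF composable_inv_right] by (simp add: inv_inv)

lemma unit_obtain_source:
  assumes "u \<in> units G"
  obtains k where "k \<in> points G" "u = star k \<cdot> k" "composable G u (star k)"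
  using assms mult_composable_left[OF composable_inv_left composable_inv_right]
  by (auto simp: units_def)

lemma unit_source: "u \<in> units G \<Longrightarrow> star u \<cdot> u = u"
  by (erule unit_obtain_source) (auto simp: composable_def inv_inv)

lemma composable_unit_left:
  assumes "u \<in> units G" "composable G u h" shows "u = h \<cdot> star h"
  using assms unit_source by (auto simp: composable_def)

lemma unit_mult_left:
  assumes "u \<in> units G" "composable G u h" shows "u \<cdot> h = h"
  using composable_unit_left[OF assms] range_mult_self assms(2) by (simp add: composable_def)

lemma units_subset_points: "units G \<subseteq> points G"
  unfolding units_def using mult_closed composable_inv_left by blast

lemma composable_range_left:
  assumes "g \<in> points G" "h \<in> points G"
  shows "composable G (g \<cdot> star g) h \<longleftrightarrow> g \<cdot> star g = h \<cdot> star h"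
  using unit_source[OF range_in_units[OF assms(1)]] range_in_units[OF assms(1)]
    units_subset_points assms
  by (auto simp: composable_def)

text \<open>A unit is composable with itself and acts trivially from the left, so \<open>u u\<^sup>*\<close> can be
  read both as the range of \<open>u\<close>, which is \<open>u\<close>, and as \<open>u\<close> acting on \<open>u\<^sup>*\<close>.\<close>

lemma unit_star:
  assumes "u \<in> units G" shows "star u = u"
proof -
  have u: "u \<in> points G" using assms units_subset_points by blast
  have "composable G u u"
    using assms by (metis unit_obtain_source mult_composable_right composable_inv_left)
  then have "u = u \<cdot> star u" by (rule composable_unit_left[OF assms])
  also have "\<dots> = star u" by (rule unit_mult_left[OF assms composable_inv_right[OF u]])
  finally show ?thesis by simp
qed

lemma bisection_units:
  assumes "U \<subseteq> units G" shows "bisection G U"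
proof -
  have "set_star G U = U" using assms unit_star by (force simp: set_star_def)
  moreover have "set_mult G U U \<subseteq> units G"
    using assms unit_mult_left by (auto simp: set_mult_def subset_iff)
  ultimately show ?thesis using assms units_subset_points by (auto simp: bisection_def)
qed

lemma bisection_mono: "bisection G U \<Longrightarrow> V \<subseteq> U \<Longrightarrow> bisection G V"
  unfolding bisection_def set_mult_def set_star_def by blast

text \<open>Passing to inverses exchanges sources with ranges and preserves bisections.\<close>

lemma bisection_source_inj:
  assumes U: "bisection G U" and g: "g \<in> U" and h: "h \<in> U" and eq: "star g \<cdot> g = star h \<cdot> h"
  shows "g = h"
proof -
  have P: "U \<subseteq> points G" using U by (simp add: bisection_def)
  then have "set_star G (set_star G U) = U" using inv_inv by (force simp: set_star_def image_image)
  then have "bisection G (set_star G U)"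
    using U P inv_closed by (auto simp: bisection_def set_star_def)
  then have "star g = star h"
    using bisection_range_inj[of "set_star G U" "star g" "star h"] g h eq inv_inv P
    by (auto simp: set_star_def subset_iff)
  then show ?thesis using inv_inv g h P by (metis subsetD)
qed

text \<open>A product \<open>g h\<^sup>*\<close> is defined only when \<open>g\<close> and \<open>h\<close> have the same source; within a bisection
  this leaves the diagonal products.\<close>

lemma set_mult_star_subset:
  assumes "bisection G U" "V \<subseteq> U"
  shows "set_mult G V (set_star G U) = (\<lambda>g. g \<cdot> star g) ` V"
proof -
  have P: "U \<subseteq> points G" using assms(1) by (simp add: bisection_def)
  have "h = g" if "g \<in> V" "h \<in> U" "composable G g (star h)" for g h
    using that assms P bisection_source_inj[OF assms(1), of h g] inv_inv
    by (auto simp: composable_def subset_iff)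
  then show ?thesis
    using assms(2) P composable_inv_right
    by (auto simp: set_mult_def set_star_def image_iff subset_iff; blast)
qed

end

section \<open>The range map on open bisections\<close>

lemma (in topological_groupoid) range_continuous:
  "continuous_map (topo G) (topo G) (\<lambda>g. g \<cdot> star g)"
proof -
  have "continuous_map (topo G) (composable_topology G) (\<lambda>g. (g, star g))"
    unfolding composable_topology_def
    using inv_continuous composable_inv_right
    by (auto simp: continuous_map_in_subtopology continuous_map_paired)
  from continuous_map_compose[OF this mult_continuous] show ?thesis by (simp add: o_def)
qed

context etale_groupoid
begin

lemma openin_set_star:
  assumes "openin (topo G) U" shows "openin (topo G) (set_star G U)"
proof -
  have P: "U \<subseteq> points G" using assms by (rule openin_subset)
  have "set_star G U = {g \<in> points G. star g \<in> U}"
    using P inv_closed inv_inv by (force simp: set_star_def image_iff subset_iff)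
  then show ?thesis using openin_continuous_map_preimage[OF inv_continuous assms] by simp
qed

lemma openin_set_mult:
  assumes "openin (topo G) U" "openin (topo G) V" shows "openin (topo G) (set_mult G U V)"
proof -
  have "openin (composable_topology G) ((U \<times> V) \<inter> {(g, h). composable G g h})"
    using assms by (auto simp: composable_topology_def openin_prod_Times_iff
        intro!: openin_subtopology_Int)
  moreover have "(\<lambda>(g, h). g \<cdot> h) ` ((U \<times> V) \<inter> {(g, h). composable G g h}) = set_mult G U V"
    by (force simp: set_mult_def)
  ultimately show ?thesis using mult_open unfolding open_map_def by metis
qed

text \<open>Openness of the range map comes from openness of the product: for open \<open>V\<close> inside a
  bisection, the image of \<open>V\<close> is the product of \<open>V\<close> with its inverse.\<close>

lemma openin_range_image:
  assumes "bisection G V" "openin (topo G) V"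
  shows "openin (topo G) ((\<lambda>g. g \<cdot> star g) ` V)"
  using set_mult_star_subset[OF assms(1) subset_refl] openin_set_mult openin_set_star assms(2)
  by metis

lemma range_homeomorphic:
  assumes U: "bisection G U" and o: "openin (topo G) U"
  shows "homeomorphic_map (subtopology (topo G) U)
    (subtopology (topo G) ((\<lambda>g. g \<cdot> star g) ` U)) (\<lambda>g. g \<cdot> star g)"
proof (rule bijective_open_imp_homeomorphic_map)
  let ?r = "\<lambda>g. g \<cdot> star g"
  have P: "U \<subseteq> points G" using U by (simp add: bisection_def)
  have oR: "openin (topo G) (?r ` U)" using openin_range_image[OF U o] .
  show "continuous_map (subtopology (topo G) U) (subtopology (topo G) (?r ` U)) ?r"
    using range_continuous
    by (auto simp: continuous_map_in_subtopology intro: continuous_map_from_subtopology)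
  show "open_map (subtopology (topo G) U) (subtopology (topo G) (?r ` U)) ?r"
    using openin_range_image bisection_mono[OF U]
    by (auto simp: open_map_def openin_open_subtopology[OF o] openin_open_subtopology[OF oR])
  show "?r ` topspace (subtopology (topo G) U) = topspace (subtopology (topo G) (?r ` U))"
    using P openin_subset[OF oR] by (auto simp: topspace_subtopology)
  show "inj_on ?r (topspace (subtopology (topo G) U))"
    using bisection_range_inj[OF U] by (auto intro!: inj_onI)
qed

end

section \<open>Evaluating the product with an adjoint\<close>

lemma S_nonzero: "a \<in> S G \<Longrightarrow> g \<in> dom a \<Longrightarrow> the (a g) \<noteq> 0"
  by (force simp: S_def ran_def)

lemma S_cmod_le_1: "a \<in> S G \<Longrightarrow> g \<in> dom a \<Longrightarrow> cmod (the (a g)) \<le> 1"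
  by (force simp: S_def ran_def)

context groupoid
begin

lemma mult_star_at_range:
  assumes a: "a \<in> S G" and g: "g \<in> dom a" "g \<in> dom b"
  shows "fun_mult G a (fun_star G b) (g \<cdot> star g) = Some (the (a g) * cnj (the (b g)))"
proof -
  have P: "g \<in> points G" using a g by (auto simp: S_def bisection_def)
  have sg: "star g \<in> set_star G (dom b)" using g(2) by (simp add: set_star_def)
  then have "star g \<in> dom (fun_star G b)" by (simp add: dom_fun_star)
  from fun_mult_apply[OF a g(1) this composable_inv_right[OF P]] sg show ?thesis
    by (simp add: fun_star_def inv_inv[OF P])
qed

text \<open>At a point of both domains, \<open>ab\<^sup>*b\<close> is \<open>a\<close> scaled by \<open>\<bar>b\<bar>\<^sup>2\<close>; both implications are read off
  from this value.\<close>

lemma mult_star_mult_apply: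
  assumes a: "a \<in> S G" and ab: "fun_mult G a (fun_star G b) \<in> S G"
    and g: "g \<in> dom a" "g \<in> dom b"
  shows "fun_mult G (fun_mult G a (fun_star G b)) b g =
    Some (the (a g) * of_real ((cmod (the (b g)))\<^sup>2))"
proof -
  have P: "g \<in> points G" using a g by (auto simp: S_def bisection_def)
  note v = mult_star_at_range[OF a g]
  have "composable G (g \<cdot> star g) g" using composable_range_left P by simp
  from fun_mult_apply[OF ab _ g(2) this] v range_mult_self[OF P]
  have "fun_mult G (fun_mult G a (fun_star G b)) b g =
      Some (the (a g) * cnj (the (b g)) * the (b g))" by auto
  then show ?thesis by (simp add: complex_norm_square mult_ac del: of_real_power)
qed

end

lemma dom_below_cmod: "a \<precsim> b \<longleftrightarrow> (\<forall>g\<in>dom a. g \<in> dom b \<and> cmod (the (b g)) = 1)"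
  by (auto simp: dom_below_def)

section \<open>The two implications\<close>

context etale_groupoid
begin

lemma dom_mult_star_below:
  assumes "b \<in> S G" "a \<precsim> b"
  shows "dom (fun_mult G a (fun_star G b)) = (\<lambda>g. g \<cdot> star g) ` dom a"
  using assms set_mult_star_subset[of "dom b" "dom a"]
  by (auto simp: dom_fun_mult dom_fun_star dom_below_cmod S_def subset_iff)

text \<open>The inverse \<open>s\<close> of the range map on \<^term>\<open>dom a\<close> presents \<open>ab\<^sup>*\<close> as a composition with
  \<open>s\<close>, which gives continuity.  Compactness of the superlevel sets goes the other way: since
  \<open>\<bar>b\<bar> = 1\<close> on \<^term>\<open>dom a\<close>, they are images of those of \<open>a\<close> under the range map.\<close>

lemma mult_star_in_E:
  assumes a: "a \<in> S G" and b: "b \<in> S G" and ab: "a \<precsim> b"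
  shows "fun_mult G a (fun_star G b) \<in> E G"
proof -
  let ?r = "\<lambda>g. g \<cdot> star g" and ?c = "fun_mult G a (fun_star G b)"
  have U: "bisection G (dom a)" and o: "openin (topo G) (dom a)" using a by (auto simp: S_def)
  then have P: "dom a \<subseteq> points G" by (simp add: bisection_def)
  have sub: "dom a \<subseteq> dom b" and b1: "\<And>g. g \<in> dom a \<Longrightarrow> cmod (the (b g)) = 1"
    using ab by (auto simp: dom_below_cmod)
  note D = dom_mult_star_below[OF b ab]
  have val: "?c (?r g) = Some (the (a g) * cnj (the (b g)))" if "g \<in> dom a" for g
    using mult_star_at_range[OF a that] that sub by blast
  have units: "dom ?c \<subseteq> units G" using D P range_in_units by auto
  have norm_val: "cmod (the (?c (?r g))) = cmod (the (a g))" if "g \<in> dom a" for g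
    using that val b1 by (simp add: norm_mult)

  have "ran ?c \<subseteq> cball 0 1 - {0}"
  proof
    fix z assume "z \<in> ran ?c"
    then obtain u where u: "?c u = Some z" by (auto simp: ran_def)
    then obtain g where g: "g \<in> dom a" "u = ?r g" using D by (metis domI imageE)
    then have "cmod z = cmod (the (a g))" using norm_val u by force
    then show "z \<in> cball 0 1 - {0}" using S_nonzero[OF a g(1)] S_cmod_le_1[OF a g(1)] by auto
  qed
  moreover have "continuous_map (subtopology (topo G) (dom ?c)) euclidean (\<lambda>u. the (?c u))"
  proof -
    obtain s where s: "homeomorphic_maps (subtopology (topo G) (dom a))
        (subtopology (topo G) (dom ?c)) ?r s"
      using range_homeomorphic[OF U o] D by (auto simp: homeomorphic_map_maps)
    have "continuous_map (subtopology (topo G) (dom a)) euclidean (\<lambda>g. the (b g))"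
      using b sub by (auto simp: S_def intro: continuous_map_from_subtopology_mono)
    then have "continuous_map (subtopology (topo G) (dom a)) euclidean
        (\<lambda>g. the (a g) * cnj (the (b g)))"
      using a by (auto simp: S_def continuous_map_atin intro!: tendsto_intros)
    then have "continuous_map (subtopology (topo G) (dom ?c)) euclidean
        ((\<lambda>g. the (a g) * cnj (the (b g))) \<circ> s)"
      using s by (auto simp: homeomorphic_maps_def intro: continuous_map_compose)
    moreover have "((\<lambda>g. the (a g) * cnj (the (b g))) \<circ> s) u = the (?c u)"
      if "u \<in> topspace (subtopology (topo G) (dom ?c))" for u
    proof -
      have "s u \<in> dom a" "?r (s u) = u"
        using s that by (auto simp: homeomorphic_maps_def continuous_map_def Pi_iff)
      then show ?thesis using val[of "s u"] by simp
    qed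
    ultimately show ?thesis by (rule continuous_map_eq)
  qed
  moreover have "compactin (topo G) {u \<in> dom ?c. \<epsilon> \<le> cmod (the (?c u))}" if "\<epsilon> > 0" for \<epsilon>
  proof -
    have "{u \<in> dom ?c. \<epsilon> \<le> cmod (the (?c u))} =
        ?r ` {g \<in> dom a. \<epsilon> \<le> cmod (the (?c (?r g)))}"
      unfolding D by blast
    also have "\<dots> = ?r ` {g \<in> dom a. \<epsilon> \<le> cmod (the (a g))}"
      by (simp add: norm_val cong: conj_cong)
    finally have "{u \<in> dom ?c. \<epsilon> \<le> cmod (the (?c u))} =
        ?r ` {g \<in> dom a. \<epsilon> \<le> cmod (the (a g))}" .
    moreover have "compactin (topo G) {g \<in> dom a. \<epsilon> \<le> cmod (the (a g))}"
      using a that by (simp add: S_def)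
    ultimately show ?thesis using image_compactin[OF _ range_continuous] by simp
  qed
  ultimately show ?thesis
    using units bisection_units openin_range_image[OF U o] D by (auto simp: E_def S_def)
qed

lemma mult_star_mult_below:
  assumes a: "a \<in> S G" and b: "b \<in> S G" and ab: "a \<precsim> b"
  shows "fun_mult G (fun_mult G a (fun_star G b)) b = a" (is "?d = a")
proof
  have c: "fun_mult G a (fun_star G b) \<in> S G" using mult_star_in_E[OF assms] by (simp add: E_def)
  have P: "dom a \<subseteq> points G" "dom b \<subseteq> points G" and U: "bisection G (dom b)"
    using a b by (auto simp: S_def bisection_def)
  have "g \<in> dom a" if "g \<in> dom ?d" for g
  proof -
    from that obtain k h where k: "k \<in> dom a" and h: "h \<in> dom b"
      and kh: "composable G (k \<cdot> star k) h" "g = (k \<cdot> star k) \<cdot> h"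
      by (auto simp: dom_fun_mult[of G _ b] dom_mult_star_below[OF b ab] set_mult_def)
    have "k \<cdot> star k = h \<cdot> star h" using kh(1) composable_range_left k h P by blast
    then have "k = h" using bisection_range_inj[OF U] ab k h by (auto simp: dom_below_cmod)
    then show ?thesis using kh(2) range_mult_self k P by auto
  qed
  moreover have "?d g = a g" if "g \<in> dom a" for g
    using mult_star_mult_apply[OF a c that] ab that by (auto simp: dom_below_cmod)
  ultimately show "?d g = a g" for g by (metis domIff)
qed

lemma below_if_mult_star_mult:
  assumes a: "a \<in> S G" and eq: "fun_mult G (fun_mult G a (fun_star G b)) b = a"
    and E: "fun_mult G a (fun_star G b) \<in> E G"
  shows "a \<precsim> b"
  unfolding dom_below_cmod
proof (intro ballI conjI)
  fix g assume g: "g \<in> dom a"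
  \<comment> \<open>Write \<open>g = u h\<close> with a unit \<open>u\<close> and \<open>h \<in> dom b\<close>; then \<open>g = h\<close>.\<close>
  then have "g \<in> set_mult G (dom (fun_mult G a (fun_star G b))) (dom b)"
    using eq dom_fun_mult by metis
  then show gb: "g \<in> dom b" using E unit_mult_left by (auto simp: set_mult_def E_def subset_iff)
  have "fun_mult G a (fun_star G b) \<in> S G" using E by (simp add: E_def)
  from mult_star_mult_apply[OF a this g gb]
  have "the (a g) = the (a g) * of_real ((cmod (the (b g)))\<^sup>2)"
    unfolding eq by (metis option.sel)
  then have "(cmod (the (b g)))\<^sup>2 = 1"
    using S_nonzero[OF a g] by (metis mult_cancel_left2 of_real_eq_1_iff)
  then show "cmod (the (b g)) = 1"
    by (smt (verit) norm_ge_zero power2_eq_1_iff)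
qed

end

theorem proposition1p1:
  fixes G :: "('g, 'm) groupoid_data_scheme"
    and a b :: "'g \<rightharpoonup> complex"
  assumes "locally_compact_etale_groupoid G"
    and "Hausdorff_space (subtopology (topo G) (units G))"
    and "a \<in> S G" and "b \<in> S G"
  shows "a \<precsim> b \<longleftrightarrow>
    a = fun_mult G (fun_mult G a (fun_star G b)) b \<and> fun_mult G a (fun_star G b) \<in> E G"
proof -
  interpret locally_compact_etale_groupoid G by fact
  show ?thesis
    using mult_star_in_E mult_star_mult_below below_if_mult_star_mult assms(3,4) by metis
qed

end
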